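(* Let $X,Y$ be indeterminates, $b_k=2k+X+Y$ for $k\ge0$ and $\lambda_k=(k+X)(k-1+Y)$ for $k\ge1$. Then for every $n\ge0$, \[ \mu_n(b_k,\lambda_k)=\sum_{\pi\in\mathfrak S_{n+1}}X^{\mathrm{RLmin}(\pi)-1}Y^{\mathrm{LRmax}(\pi)-\mathrm{pivot}(\pi)} . \]
   Context: For sequences $(b_k)_{k\ge0}$, $(\lambda_k)_{k\ge1}$ let $p_n$ be the monic polynomials with $p_{-1}=0$, $p_0=1$, $p_{n+1}=(x-b_n)p_n-\lambda_np_{n-1}$; $\mu_n(b_k,\lambda_k)$ denotes $\mathcal L(x^n)$, where $\mathcal L$ is the unique linear functional on polynomials with $\mathcal L(1)=1$ and $\mathcal L(p_m)=0$ for all $m\ge1$. $\mathfrak S_n$ is the set of permutations $\pi=\pi_1\cdots\pi_n$ of $\{1,\dots,n\}$. $\pi_i$ is a right-to-left minimum if $\pi_i<\pi_j$ for all $j>i$, and a left-to-right maximum if $\pi_i>\pi_j$ for all $j<i$; $\mathrm{RLmin}(\pi)$, $\mathrm{LRmax}(\pi)$ are their numbers. A pivot is an entry that is both a left-to-right maximum and a right-to-left minimum; $\mathrm{pivot}(\pi)$ is their number. *)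

theory Defs
  imports Complex_Main "HOL-Computational_Algebra.Polynomial" "HOL-Combinatorics.Permutations"
begin

text \<open>The convention \<open>p\<^sub>-\<^sub>1 = 0\<close> is absorbed into the second equation.\<close>

fun orth_poly :: "(nat \<Rightarrow> 'a::comm_ring_1) \<Rightarrow> (nat \<Rightarrow> 'a) \<Rightarrow> nat \<Rightarrow> 'a poly" where
  "orth_poly b l 0 = 1"
| "orth_poly b l (Suc 0) = [:- b 0, 1:]"
| "orth_poly b l (Suc (Suc n)) =
     [:- b (Suc n), 1:] * orth_poly b l (Suc n) - smult (l (Suc n)) (orth_poly b l n)"

definition is_moment_functional ::
  "(nat \<Rightarrow> 'a::comm_ring_1) \<Rightarrow> (nat \<Rightarrow> 'a) \<Rightarrow> ('a poly \<Rightarrow> 'a) \<Rightarrow> bool" where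
  "is_moment_functional b l L \<longleftrightarrow>
     module_hom smult (*) L \<and> L 1 = 1 \<and> (\<forall>m\<ge>1. L (orth_poly b l m) = 0)"

definition moment_functional ::
  "(nat \<Rightarrow> 'a::comm_ring_1) \<Rightarrow> (nat \<Rightarrow> 'a) \<Rightarrow> 'a poly \<Rightarrow> 'a" where
  "moment_functional b l = (THE L. is_moment_functional b l L)"

definition moment :: "(nat \<Rightarrow> 'a::comm_ring_1) \<Rightarrow> (nat \<Rightarrow> 'a) \<Rightarrow> nat \<Rightarrow> 'a" where
  "moment b l n = moment_functional b l (monom 1 n)"

text \<open>A permutation of \<open>{1..n}\<close> in one-line notation is the function \<open>i \<mapsto> \<pi>\<^sub>i\<close>.
  The sets below consist of positions, which are in bijection with the entries.\<close>

definition rl_minima :: "nat \<Rightarrow> (nat \<Rightarrow> nat) \<Rightarrow> nat set" where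
  "rl_minima n \<pi> = {i \<in> {1..n}. \<forall>j \<in> {1..n}. i < j \<longrightarrow> \<pi> i < \<pi> j}"

definition lr_maxima :: "nat \<Rightarrow> (nat \<Rightarrow> nat) \<Rightarrow> nat set" where
  "lr_maxima n \<pi> = {i \<in> {1..n}. \<forall>j \<in> {1..n}. j < i \<longrightarrow> \<pi> j < \<pi> i}"

definition RLmin :: "nat \<Rightarrow> (nat \<Rightarrow> nat) \<Rightarrow> nat" where
  "RLmin n \<pi> = card (rl_minima n \<pi>)"

definition LRmax :: "nat \<Rightarrow> (nat \<Rightarrow> nat) \<Rightarrow> nat" where
  "LRmax n \<pi> = card (lr_maxima n \<pi>)"

definition pivot :: "nat \<Rightarrow> (nat \<Rightarrow> nat) \<Rightarrow> nat" where
  "pivot n \<pi> = card (lr_maxima n \<pi> \<inter> rl_minima n \<pi>)"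

text \<open>The bivariate polynomial ring is encoded as \<open>R[X][Y]\<close>, so \<open>X\<close> is a constant in \<open>Y\<close>.\<close>

definition indet_X :: "'a::comm_ring_1 poly poly" where
  "indet_X = [:[:0, 1:]:]"

definition indet_Y :: "'a::comm_ring_1 poly poly" where
  "indet_Y = [:0, 1:]"


text \<open>The truncated subtractions \<open>RLmin - 1\<close> and \<open>LRmax - pivot\<close> never truncate.\<close>

lemma RLmin_ge_1: "1 \<le> RLmin (Suc n) \<pi>"
proof -
  have "Suc n \<in> rl_minima (Suc n) \<pi>" and "finite (rl_minima (Suc n) \<pi>)"
    by (auto simp: rl_minima_def)
  then show ?thesis
    unfolding RLmin_def by (metis One_nat_def Suc_leI card_gt_0_iff empty_iff)
qed

lemma pivot_le_LRmax: "pivot n \<pi> \<le> LRmax n \<pi>"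
  unfolding pivot_def LRmax_def by (rule card_mono) (auto simp: lr_maxima_def)


lemma coeff_orth_poly:
  "coeff (orth_poly b l n) n = 1 \<and> (\<forall>i>n. coeff (orth_poly b l n) i = 0)"
proof (induction b l n rule: orth_poly.induct)
  case (1 b l)
  then show ?case by (auto simp: coeff_eq_0)
next
  case (2 b l)
  then show ?case by (auto simp: coeff_eq_0)
next
  case (3 b l n)
  show ?case
  proof (intro conjI allI impI)
    show "coeff (orth_poly b l (Suc (Suc n))) (Suc (Suc n)) = 1"
      using 3 by simp
    fix i assume "i > Suc (Suc n)"
    then show "coeff (orth_poly b l (Suc (Suc n))) i = 0"
      using 3 by (cases i) auto
  qed
qed

lemma is_moment_functional_unique:
  assumes "is_moment_functional b l L" "is_moment_functional b l L'"
  shows "L = L'"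
proof
  fix q
  interpret L: module_hom smult "(*)" L using assms(1) by (simp add: is_moment_functional_def)
  interpret L': module_hom smult "(*)" L' using assms(2) by (simp add: is_moment_functional_def)
  have eq: "L (orth_poly b l n) = L' (orth_poly b l n)" for n
    using assms by (cases n) (auto simp: is_moment_functional_def)
  have "(\<forall>i\<ge>n. coeff q i = 0) \<longrightarrow> L q = L' q" for n q
  proof (induction n arbitrary: q)
    case 0
    have "q = 0" if "\<forall>i. coeff q i = 0" using that by (simp add: poly_eq_iff)
    then show ?case by auto
  next
    case (Suc n)
    show ?case
    proof
      assume *: "\<forall>i\<ge>Suc n. coeff q i = 0"
      define r where "r = q - smult (coeff q n) (orth_poly b l n)"
      have "\<forall>i\<ge>n. coeff r i = 0"
      proof (intro allI impI)
        fix i assume "i \<ge> n"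
        then show "coeff r i = 0"
          using * coeff_orth_poly[of b l n] by (cases "i = n") (auto simp: r_def)
      qed
      then have "L r = L' r" using Suc.IH by blast
      moreover have "q = r + smult (coeff q n) (orth_poly b l n)" by (simp add: r_def)
      ultimately show "L q = L' q"
        using eq by (metis L.add L'.add L.scale L'.scale)
    qed
  qed
  from this[of "Suc (degree q)" q] show "L q = L' q" by (auto simp: coeff_eq_0)
qed

fun moment_aux :: "(nat \<Rightarrow> 'a::comm_ring_1) \<Rightarrow> (nat \<Rightarrow> 'a) \<Rightarrow> nat \<Rightarrow> 'a" where
  "moment_aux b l n =
     (if n = 0 then 1 else - (\<Sum>i<n. coeff (orth_poly b l n) i * moment_aux b l i))"

declare moment_aux.simps [simp del]

lemma is_moment_functional_exists: "\<exists>L. is_moment_functional b l L"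
proof
  let ?m = "moment_aux b l"
  define L where "L q = (\<Sum>i\<le>degree q. coeff q i * ?m i)" for q
  have L: "L q = (\<Sum>i\<le>N. coeff q i * ?m i)" if "degree q \<le> N" for q N
    unfolding L_def by (rule sum.mono_neutral_left) (use that in \<open>auto simp: coeff_eq_0\<close>)
  have add: "L (p + q) = L p + L q" for p q
  proof -
    define N where "N = max (degree p) (degree q)"
    have "degree (p + q) \<le> N" "degree p \<le> N" "degree q \<le> N"
      by (auto simp: N_def degree_add_le_max)
    then show ?thesis by (simp add: L sum.distrib distrib_right)
  qed
  have scale: "L (smult c p) = c * L p" for c p
    using L[of "smult c p" "degree p"]
    by (simp add: L[of p "degree p"] degree_smult_le sum_distrib_left mult.assoc)
  have one: "L 1 = 1" by (simp add: L_def moment_aux.simps)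
  have zero: "L (orth_poly b l m) = 0" if "m \<ge> 1" for m
  proof -
    have "degree (orth_poly b l m) \<le> m"
      using coeff_orth_poly[of b l m] by (auto intro: degree_le)
    then have "L (orth_poly b l m) = (\<Sum>i\<le>m. coeff (orth_poly b l m) i * ?m i)" by (rule L)
    also have "\<dots> = (\<Sum>i<m. coeff (orth_poly b l m) i * ?m i) + ?m m"
      using coeff_orth_poly[of b l m] by (simp add: lessThan_Suc_atMost[symmetric])
    also have "\<dots> = 0" using that by (subst (2) moment_aux.simps) simp
    finally show ?thesis .
  qed
  have "module_hom smult (*) L"
    by unfold_locales (auto simp: smult_add_right smult_add_left algebra_simps add scale)
  with one zero show "is_moment_functional b l L" by (simp add: is_moment_functional_def)
qed

lemma moment_functional: "is_moment_functional b l (moment_functional b l)"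
  unfolding moment_functional_def
  using is_moment_functional_exists is_moment_functional_unique by (metis theI)

end

theory Submission
  imports Defs
begin

text \<open>
  Reveal a permutation matrix of size \<open>N\<close> by adding columns and rows alternately. At every stage
  one sees a partial permutation inside \<open>{1..a} \<times> {1..b}\<close>, with \<open>b = a\<close> or \<open>b = a + 1\<close>, and it is
  already decided which of its entries will be left-to-right maxima or right-to-left minima.
  A new column either stays empty or is matched with one of the empty rows, and only the topmost
  empty row produces a left-to-right maximum; dually for a new row and right-to-left minima. Hence
  the weighted numbers of partial permutations with \<open>k\<close> empty rows satisfy two-term recurrences with
  coefficients \<open>k + Y\<close> and \<open>k + X\<close>. Composing a row step with a column step gives the three-term
  recurrence for the coefficients of \<open>x ^ n\<close> in the basis of the orthogonal polynomials.
  In a full permutation the last row always contributes the factor \<open>X\<close>, which is cancelled.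
\<close>

section \<open>Moments from the expansion of powers in the orthogonal basis\<close>

text \<open>Think of \<open>M n k\<close> as the coefficient of the \<open>k\<close>-th orthogonal
  polynomial in \<open>x ^ n\<close>. The recurrences express multiplication by \<open>x\<close> in
  that basis, and the moment functional keeps only the coefficient at \<open>k = 0\<close>.\<close>

lemma moment_eqI:
  fixes b l :: "nat \<Rightarrow> 'a::comm_ring_1"
  assumes M_0: "\<And>k. M 0 k = (if k = 0 then 1 else 0)"
    and M_Suc_0: "\<And>n. M (Suc n) 0 = b 0 * M n 0 + l 1 * M n 1"
    and M_Suc_Suc: "\<And>n k. M (Suc n) (Suc k) =
      M n k + b (Suc k) * M n (Suc k) + l (Suc (Suc k)) * M n (Suc (Suc k))"
  shows "moment b l n = M n 0"
proof -
  let ?p = "orth_poly b l"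
  have zero: "M n k = 0" if "n < k" for n k
    using that
  proof (induction n arbitrary: k)
    case (Suc n)
    then show ?case by (cases k) (auto simp: M_Suc_Suc)
  qed (simp add: M_0)
  have x_p_0: "[:0, 1:] * ?p 0 = ?p 1 + smult (b 0) (?p 0)"
    by (simp add: one_pCons)
  have x_p_Suc: "[:0, 1:] * ?p (Suc k) =
      ?p (Suc (Suc k)) + smult (b (Suc k)) (?p (Suc k)) + smult (l (Suc k)) (?p k)" for k
    by simp
  have expand: "monom 1 n = (\<Sum>k\<le>N. smult (M n k) (?p k))" if "n \<le> N" for n N
    using that
  proof (induction n arbitrary: N)
    case 0
    have "(\<Sum>k\<le>N. smult (M 0 k) (?p k)) = (\<Sum>k\<in>{0}. smult (M 0 k) (?p k))"
      by (rule sum.mono_neutral_right) (auto simp: M_0)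
    then show ?case by (simp add: M_0)
  next
    case (Suc n)
    then obtain N' where N: "N = Suc N'" and "n \<le> N'"
      by (cases N) auto
    have "monom 1 (Suc n) = [:0, 1:] * (monom 1 n :: 'a poly)"
      by (simp add: monom_Suc)
    also have "\<dots> = [:0, 1:] * (\<Sum>k\<le>Suc N'. smult (M n k) (?p k))"
      using Suc.IH[of "Suc N'"] \<open>n \<le> N'\<close> by simp
    also have "\<dots> = (\<Sum>k\<le>Suc N'. smult (M n k) ([:0, 1:] * ?p k))"
      by (simp only: sum_distrib_left mult_smult_right)
    also have "\<dots> = smult (M n 0) ([:0, 1:] * ?p 0) +
        (\<Sum>k\<le>N'. smult (M n (Suc k)) ([:0, 1:] * ?p (Suc k)))"
      by (rule sum.atMost_Suc_shift)
    also have "\<dots> = smult (M n 0) (?p 1) + smult (b 0 * M n 0) (?p 0) +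
        ((\<Sum>k\<le>N'. smult (M n (Suc k)) (?p (Suc (Suc k)))) +
         (\<Sum>k\<le>N'. smult (b (Suc k) * M n (Suc k)) (?p (Suc k))) +
         (\<Sum>k\<le>N'. smult (l (Suc k) * M n (Suc k)) (?p k)))"
      by (simp only: x_p_0 x_p_Suc smult_add_right smult_smult sum.distrib) (simp only: mult.commute)
    also have "(\<Sum>k\<le>N'. smult (M n (Suc k)) (?p (Suc (Suc k)))) =
        (\<Sum>k\<le>N'. smult (M n k) (?p (Suc k))) - smult (M n 0) (?p 1)"
    proof -
      have "(\<Sum>k\<le>Suc N'. smult (M n k) (?p (Suc k))) = (\<Sum>k\<le>N'. smult (M n k) (?p (Suc k)))"
        using zero[of n "Suc N'"] \<open>n \<le> N'\<close> by simp
      moreover have "(\<Sum>k\<le>Suc N'. smult (M n k) (?p (Suc k))) =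
          smult (M n 0) (?p 1) + (\<Sum>k\<le>N'. smult (M n (Suc k)) (?p (Suc (Suc k))))"
        by (simp only: sum.atMost_Suc_shift One_nat_def)
      ultimately show ?thesis by (simp only: algebra_simps)
    qed
    also have "(\<Sum>k\<le>N'. smult (l (Suc k) * M n (Suc k)) (?p k)) =
        smult (l 1 * M n 1) (?p 0) +
        (\<Sum>k\<le>N'. smult (l (Suc (Suc k)) * M n (Suc (Suc k))) (?p (Suc k)))"
    proof -
      have "(\<Sum>k\<le>N'. smult (l (Suc k) * M n (Suc k)) (?p k)) =
          (\<Sum>k\<le>Suc N'. smult (l (Suc k) * M n (Suc k)) (?p k))"
        using zero[of n "Suc (Suc N')"] \<open>n \<le> N'\<close> by simp
      then show ?thesis by (simp only: sum.atMost_Suc_shift One_nat_def)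
    qed
    also have "smult (M n 0) (?p 1) + smult (b 0 * M n 0) (?p 0) +
        ((\<Sum>k\<le>N'. smult (M n k) (?p (Suc k))) - smult (M n 0) (?p 1) +
         (\<Sum>k\<le>N'. smult (b (Suc k) * M n (Suc k)) (?p (Suc k))) +
         (smult (l 1 * M n 1) (?p 0) +
          (\<Sum>k\<le>N'. smult (l (Suc (Suc k)) * M n (Suc (Suc k))) (?p (Suc k))))) =
        smult (M (Suc n) 0) (?p 0) + (\<Sum>k\<le>N'. smult (M (Suc n) (Suc k)) (?p (Suc k)))"
      by (simp only: M_Suc_0 M_Suc_Suc smult_add_left sum.distrib add.assoc add.commute
        add.left_commute diff_conv_add_uminus add.right_inverse add_minus_cancel minus_add_cancel)
    also have "\<dots> = (\<Sum>k\<le>N. smult (M (Suc n) k) (?p k))"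
      by (simp only: N sum.atMost_Suc_shift)
    finally show ?case .
  qed
  let ?L = "moment_functional b l"
  have L: "module_hom smult (*) ?L" "?L 1 = 1" "\<And>m. m \<ge> 1 \<Longrightarrow> ?L (?p m) = 0"
    using moment_functional[of b l] by (auto simp: is_moment_functional_def)
  interpret L: module_hom smult "(*)" ?L by (rule L(1))
  have "moment b l n = (\<Sum>k\<le>n. M n k * ?L (?p k))"
    unfolding moment_def by (subst expand[OF order_refl]) (simp add: L.sum L.scale)
  also have "\<dots> = (\<Sum>k\<in>{0}. M n k * ?L (?p k))"
    by (rule sum.mono_neutral_right) (auto simp: L(3))
  finally show ?thesis by (simp add: L(2))
qed

section \<open>Partial permutations\<close>

text \<open>Non-attacking rooks on a board: \<open>(i, v)\<close> stands for value \<open>v\<close>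
  at position \<open>i\<close>, so rows are positions and columns are values.\<close>

definition placements :: "nat \<Rightarrow> nat \<Rightarrow> (nat \<times> nat) set set" where
  "placements a b =
    {\<sigma>. \<sigma> \<subseteq> {1..a} \<times> {1..b} \<and> single_valued \<sigma> \<and> single_valued (\<sigma>\<inverse>)}"

text \<open>Empty rows \<open>j < i\<close> refute \<open>is_record\<close>, since they will receive values that are larger than
  all present ones. By pigeonhole, \<open>is_antirecord\<close> is the condition for right-to-left minima;
  this form makes the two notions transposes of each other.\<close>

definition is_record :: "(nat \<times> nat) set \<Rightarrow> nat \<times> nat \<Rightarrow> bool" where
  "is_record \<sigma> p \<longleftrightarrow> (\<forall>j\<in>{1..<fst p}. \<exists>w<snd p. (j, w) \<in> \<sigma>)"

definition is_antirecord :: "(nat \<times> nat) set \<Rightarrow> nat \<times> nat \<Rightarrow> bool" where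
  "is_antirecord \<sigma> p \<longleftrightarrow> (\<forall>w\<in>{1..<snd p}. \<exists>j<fst p. (j, w) \<in> \<sigma>)"

text \<open>With an arbitrary \<open>f\<close> of the two flags, transposing the board amounts to
  swapping the arguments of \<open>f\<close>.\<close>

definition weight :: "(bool \<Rightarrow> bool \<Rightarrow> 'a::comm_ring_1) \<Rightarrow> (nat \<times> nat) set \<Rightarrow> 'a" where
  "weight f \<sigma> = (\<Prod>p\<in>\<sigma>. f (is_antirecord \<sigma> p) (is_record \<sigma> p))"

text \<open>The parameter \<open>k\<close> counts empty rows. In its additive form the condition has
  no solution when \<open>k\<close> exceeds \<open>a\<close>.\<close>

definition placement_sum ::
  "(bool \<Rightarrow> bool \<Rightarrow> 'a::comm_ring_1) \<Rightarrow> nat \<Rightarrow> nat \<Rightarrow> nat \<Rightarrow> 'a" where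
  "placement_sum f a b k = (\<Sum>\<sigma> | \<sigma> \<in> placements a b \<and> card \<sigma> + k = a. weight f \<sigma>)"

lemma finite_placements [simp]: "finite (placements a b)"
proof (rule finite_subset)
  show "placements a b \<subseteq> Pow ({1..a} \<times> {1..b})"
    by (auto simp: placements_def)
qed simp

lemma placements_finite: "\<sigma> \<in> placements a b \<Longrightarrow> finite \<sigma>"
  by (auto simp: placements_def intro: finite_subset)

lemma card_Domain_placement: "\<sigma> \<in> placements a b \<Longrightarrow> card (Domain \<sigma>) = card \<sigma>"
  unfolding Domain_fst
  by (rule card_image) (force simp: placements_def single_valued_def inj_on_def)

lemma card_Range_placement: "\<sigma> \<in> placements a b \<Longrightarrow> card (Range \<sigma>) = card \<sigma>"
  unfolding Range_snd
  by (rule card_image) (force simp: placements_def single_valued_def inj_on_def)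

section \<open>Transposing the board\<close>

lemma converse_placements: "\<sigma>\<inverse> \<in> placements b a \<longleftrightarrow> \<sigma> \<in> placements a b"
  by (auto simp: placements_def)

lemma weight_converse: "weight f (\<sigma>\<inverse>) = weight (\<lambda>x y. f y x) \<sigma>"
proof -
  have "\<sigma>\<inverse> = prod.swap ` \<sigma>" by auto
  then have "weight f (\<sigma>\<inverse>) =
      (\<Prod>p\<in>\<sigma>. f (is_antirecord (\<sigma>\<inverse>) (prod.swap p)) (is_record (\<sigma>\<inverse>) (prod.swap p)))"
    unfolding weight_def by (simp only: prod.reindex[OF inj_swap] o_def)
  then show ?thesis
    by (simp add: weight_def is_record_def is_antirecord_def)
qed

text \<open>The \<open>k\<close> empty columns counted on the left become empty rows, so facts about
  a new column transfer to a new row.\<close>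

lemma placement_sum_converse:
  "(\<Sum>\<sigma> | \<sigma> \<in> placements a b \<and> card \<sigma> + k = b. weight f \<sigma>) =
    placement_sum (\<lambda>x y. f y x) b a k"
  unfolding placement_sum_def
  by (rule sum.reindex_bij_witness[of _ converse converse])
    (auto simp: converse_placements weight_converse card_inverse)

lemma placement_sum_eq_0: "b + k < a \<Longrightarrow> placement_sum f a b k = 0"
proof -
  assume *: "b + k < a"
  have "card \<sigma> \<le> b" if "\<sigma> \<in> placements a b" for \<sigma>
  proof -
    have "card (Range \<sigma>) \<le> card {1..b}"
      by (rule card_mono) (use that in \<open>auto simp: placements_def\<close>)
    then show ?thesis using card_Range_placement[OF that] by simp
  qed
  then show ?thesis
    using * unfolding placement_sum_def by (intro sum.neutral) fastforce
qed

section \<open>Adding one column to the board\<close>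

lemma weight_insert_column:
  assumes \<sigma>: "\<sigma> \<in> placements a b" and i: "i \<in> {1..a} - Domain \<sigma>"
  shows "weight f (insert (i, Suc b) \<sigma>) =
    f (is_antirecord \<sigma> (i, Suc b)) (is_record \<sigma> (i, Suc b)) * weight f \<sigma>"
proof -
  let ?\<tau> = "insert (i, Suc b) \<sigma>"
  \<comment> \<open>Both flags of \<open>p\<close> depend only on the columns to the left of
    \<open>p\<close>, so an entry in column \<open>Suc b\<close> changes no earlier
    decision.\<close>
  have new: "is_antirecord ?\<tau> p = is_antirecord \<sigma> p" "is_record ?\<tau> p = is_record \<sigma> p"
    if "snd p \<le> Suc b" for p
    using that by (auto simp: is_antirecord_def is_record_def)
  have "snd p \<le> Suc b" if "p \<in> \<sigma>" for p
    using that \<sigma> by (force simp: placements_def)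
  moreover have "(i, Suc b) \<notin> \<sigma>" using i by auto
  ultimately show ?thesis
    using placements_finite[OF \<sigma>] by (auto simp: weight_def new intro!: prod.cong)
qed

text \<open>The second alternative in the hypothesis concerns the step in which \<open>k = 0\<close> and the new
  entry may be a pivot.\<close>

lemma sum_open_rows:
  fixes f :: "bool \<Rightarrow> bool \<Rightarrow> 'a::comm_ring_1"
  assumes \<sigma>: "\<sigma> \<in> placements a b" and k: "card \<sigma> + Suc k = a"
    and f: "f False False = 1" "f False True = y"
    and ab: "a \<le> b \<or> a = Suc b \<and> f True True = y"
  shows "(\<Sum>i\<in>{1..a} - Domain \<sigma>. f (is_antirecord \<sigma> (i, Suc b)) (is_record \<sigma> (i, Suc b))) =
    of_nat k + y"
proof -
  define E where "E = {1..a} - Domain \<sigma>"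
  define m where "m = Min E"
  have Dom: "Domain \<sigma> \<subseteq> {1..a}" and Ran: "Range \<sigma> \<subseteq> {1..b}"
    using \<sigma> by (auto simp: placements_def)
  have card_E: "card E = Suc k"
    using Dom card_Domain_placement[OF \<sigma>] k
    by (simp add: E_def card_Diff_subset finite_subset[OF Dom])
  have fin: "finite E" by (simp add: E_def)
  have "E \<noteq> {}" using card_E by auto
  then have m: "m \<in> E" "\<And>i. i \<in> E \<Longrightarrow> m \<le> i"
    using fin by (auto simp: m_def)
  have record_iff: "is_record \<sigma> (i, Suc b) \<longleftrightarrow> i = m" if "i \<in> E" for i
  proof
    assume *: "is_record \<sigma> (i, Suc b)"
    have "\<not> m < i"
    proof
      assume "m < i"
      then have "m \<in> Domain \<sigma>" using * m(1) by (force simp: is_record_def E_def)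
      then show False using m(1) by (simp add: E_def)
    qed
    then show "i = m" using m(2)[OF that] by simp
  next
    assume "i = m"
    show "is_record \<sigma> (i, Suc b)"
      unfolding is_record_def
    proof
      fix j assume j: "j \<in> {1..<fst (i, Suc b)}"
      then have "j \<in> {1..a}" "j < m" using that \<open>i = m\<close> by (auto simp: E_def)
      then have "j \<in> Domain \<sigma>" using m(2)[of j] by (auto simp: E_def)
      then obtain w where "(j, w) \<in> \<sigma>" by blast
      moreover have "w \<le> b" using Ran calculation by auto
      ultimately show "\<exists>w<snd (i, Suc b). (j, w) \<in> \<sigma>" by (intro exI[of _ w]) simp
    qed
  qed
  \<comment> \<open>An antirecord in the new column needs all \<open>b\<close> earlier columns
    filled. Then \<open>b \<le> card \<sigma> = a - Suc k\<close>, which excludes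
    \<open>a \<le> b\<close> and forces \<open>k = 0\<close> if \<open>a = Suc b\<close>.\<close>
  have antirecordD: "k = 0 \<and> a = Suc b" if "is_antirecord \<sigma> (i, Suc b)" for i
  proof -
    have "{1..b} \<subseteq> Range \<sigma>" using that by (force simp: is_antirecord_def)
    then have "card {1..b} \<le> card (Range \<sigma>)"
      by (intro card_mono) (auto intro: finite_subset[OF Ran])
    then have "b \<le> card \<sigma>" using card_Range_placement[OF \<sigma>] by simp
    then show ?thesis using k ab by auto
  qed
  have "(\<Sum>i\<in>E. f (is_antirecord \<sigma> (i, Suc b)) (is_record \<sigma> (i, Suc b))) =
      f (is_antirecord \<sigma> (m, Suc b)) True +
      (\<Sum>i\<in>E - {m}. f (is_antirecord \<sigma> (i, Suc b)) (is_record \<sigma> (i, Suc b)))"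
    using m(1) fin record_iff[OF m(1)] by (simp add: sum.remove)
  also have "f (is_antirecord \<sigma> (m, Suc b)) True = y"
    using f ab antirecordD[of m] by (cases "is_antirecord \<sigma> (m, Suc b)") auto
  also have "(\<Sum>i\<in>E - {m}. f (is_antirecord \<sigma> (i, Suc b)) (is_record \<sigma> (i, Suc b))) =
      (\<Sum>i\<in>E - {m}. 1)"
  proof (rule sum.cong)
    fix i assume i: "i \<in> E - {m}"
    \<comment> \<open>An antirecord would give \<open>k = 0\<close>, making \<open>m\<close> the
      only element of \<open>E\<close>.\<close>
    then have "\<not> is_antirecord \<sigma> (i, Suc b)"
      using antirecordD[of i] card_E m(1) by (auto simp: card_Suc_eq)
    then show "f (is_antirecord \<sigma> (i, Suc b)) (is_record \<sigma> (i, Suc b)) = 1"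
      using record_iff i f by simp
  qed simp
  also have "\<dots> = of_nat k" using card_E m(1) by simp
  finally show ?thesis by (simp add: E_def add.commute)
qed

text \<open>Either the new column is empty, or deleting its entry leaves \<open>k + 1\<close> empty
  rows; putting the entry back in each of these rows contributes the total factor
  \<open>k + y\<close> by \<open>sum_open_rows\<close>.\<close>

lemma placement_sum_add_column:
  fixes f :: "bool \<Rightarrow> bool \<Rightarrow> 'a::comm_ring_1"
  assumes f: "f False False = 1" "f False True = y"
    and ab: "a \<le> b \<or> a = Suc b \<and> f True True = y"
  shows "placement_sum f a (Suc b) k =
    placement_sum f a b k + (of_nat k + y) * placement_sum f a b (Suc k)"
proof -
  define A where "A = {\<sigma>. \<sigma> \<in> placements a b \<and> card \<sigma> + k = a}"
  define B where "B = {\<sigma>. \<sigma> \<in> placements a b \<and> card \<sigma> + Suc k = a}"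
  define C where "C = {\<sigma>. \<sigma> \<in> placements a (Suc b) \<and> card \<sigma> + k = a}"
  define D where "D = (SIGMA \<sigma>:B. {1..a} - Domain \<sigma>)"
  define g where "g = (\<lambda>(\<sigma>, i). insert (i :: nat, Suc b) \<sigma>)"
  have [simp]: "finite A" "finite B" "finite C" by (simp_all add: A_def B_def C_def)
  have old: "p \<in> {1..a} \<times> {1..b}" if "\<sigma> \<in> placements a b" "p \<in> \<sigma>" for \<sigma> p
    using that by (auto simp: placements_def)
  have unused: "{\<sigma> \<in> C. Suc b \<notin> Range \<sigma>} = A"
    by (force simp: A_def C_def placements_def le_Suc_eq)
  have used: "bij_betw g D {\<sigma> \<in> C. Suc b \<in> Range \<sigma>}"
  proof (rule bij_betwI')
    fix s t assume st: "s \<in> D" "t \<in> D"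
    obtain \<sigma> i \<tau> j where [simp]: "s = (\<sigma>, i)" "t = (\<tau>, j)" by (cases s, cases t)
    have \<sigma>: "\<sigma> \<subseteq> {1..a} \<times> {1..b}" and \<tau>: "\<tau> \<subseteq> {1..a} \<times> {1..b}"
      using st by (auto simp: D_def B_def placements_def)
    show "g s = g t \<longleftrightarrow> s = t"
    proof
      assume eq: "g s = g t"
      have "\<sigma> = {p \<in> g s. snd p \<le> b}" using \<sigma> by (auto simp: g_def)
      moreover have "\<tau> = {p \<in> g t. snd p \<le> b}" using \<tau> by (auto simp: g_def)
      moreover have "(i, Suc b) \<in> g t" using eq by (auto simp: g_def)
      then have "i = j" using \<tau> by (auto simp: g_def)
      ultimately show "s = t" using eq by simp
    qed simp
  next
    fix s assume "s \<in> D"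
    moreover obtain \<sigma> i where [simp]: "s = (\<sigma>, i)" by (cases s)
    ultimately have \<sigma>: "\<sigma> \<in> placements a b" "card \<sigma> + Suc k = a" and i: "i \<in> {1..a} - Domain \<sigma>"
      by (auto simp: D_def B_def)
    have "Suc b \<notin> Range \<sigma>" using old[OF \<sigma>(1)] by force
    then have "g s \<in> placements a (Suc b)"
      using \<sigma>(1) i by (auto simp: g_def placements_def single_valued_def)
    moreover have "card (g s) = Suc (card \<sigma>)"
      using i placements_finite[OF \<sigma>(1)] by (subst g_def) (auto simp: card_insert_if)
    ultimately show "g s \<in> {\<sigma> \<in> C. Suc b \<in> Range \<sigma>}"
      using \<sigma>(2) by (auto simp: C_def g_def)
  next
    fix \<tau> assume "\<tau> \<in> {\<sigma> \<in> C. Suc b \<in> Range \<sigma>}"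
    then obtain i where \<tau>: "\<tau> \<in> placements a (Suc b)" "card \<tau> + k = a" and i: "(i, Suc b) \<in> \<tau>"
      by (auto simp: C_def)
    define \<sigma> where "\<sigma> = \<tau> - {(i, Suc b)}"
    have "\<sigma> \<subseteq> {1..a} \<times> {1..b}"
    proof
      fix p assume p: "p \<in> \<sigma>"
      obtain j w where [simp]: "p = (j, w)" by (cases p)
      have "w \<noteq> Suc b"
        using p i \<tau>(1) by (auto simp: \<sigma>_def placements_def single_valued_def)
      then show "p \<in> {1..a} \<times> {1..b}"
        using p \<tau>(1) by (auto simp: \<sigma>_def placements_def)
    qed
    then have "\<sigma> \<in> placements a b"
      using \<tau>(1) by (auto simp: \<sigma>_def placements_def single_valued_def)
    moreover have "card \<tau> = Suc (card \<sigma>)"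
      unfolding \<sigma>_def using i placements_finite[OF \<tau>(1)] by (simp only: card_Suc_Diff1)
    moreover have "i \<in> {1..a} - Domain \<sigma>"
      using i \<tau>(1) by (auto simp: \<sigma>_def placements_def single_valued_def)
    ultimately have "(\<sigma>, i) \<in> D" using \<tau>(2) by (auto simp: D_def B_def)
    moreover have "\<tau> = g (\<sigma>, i)" using i by (auto simp: g_def \<sigma>_def)
    ultimately show "\<exists>s\<in>D. \<tau> = g s" by blast
  qed
  have "placement_sum f a (Suc b) k = sum (weight f) C"
    by (simp add: placement_sum_def C_def)
  also have "C = {\<sigma> \<in> C. Suc b \<notin> Range \<sigma>} \<union> {\<sigma> \<in> C. Suc b \<in> Range \<sigma>}" by blast
  also have "sum (weight f) \<dots> = sum (weight f) A + sum (weight f) {\<sigma> \<in> C. Suc b \<in> Range \<sigma>}"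
    by (subst sum.union_disjoint) (use unused in auto)
  also have "sum (weight f) {\<sigma> \<in> C. Suc b \<in> Range \<sigma>} = (\<Sum>s\<in>D. weight f (g s))"
    by (rule sum.reindex_bij_betw[OF used, symmetric])
  also have "\<dots> = (\<Sum>\<sigma>\<in>B. \<Sum>i\<in>{1..a} - Domain \<sigma>. weight f (insert (i, Suc b) \<sigma>))"
    unfolding D_def g_def by (subst sum.Sigma) (auto intro!: sum.cong)
  also have "\<dots> = (\<Sum>\<sigma>\<in>B. (of_nat k + y) * weight f \<sigma>)"
  proof (rule sum.cong)
    fix \<sigma> assume "\<sigma> \<in> B"
    then have \<sigma>: "\<sigma> \<in> placements a b" "card \<sigma> + Suc k = a" by (auto simp: B_def)
    have "(\<Sum>i\<in>{1..a} - Domain \<sigma>. weight f (insert (i, Suc b) \<sigma>)) =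
        (\<Sum>i\<in>{1..a} - Domain \<sigma>.
          f (is_antirecord \<sigma> (i, Suc b)) (is_record \<sigma> (i, Suc b)) * weight f \<sigma>)"
      by (rule sum.cong) (simp_all add: weight_insert_column[OF \<sigma>(1)])
    then show "(\<Sum>i\<in>{1..a} - Domain \<sigma>. weight f (insert (i, Suc b) \<sigma>)) =
        (of_nat k + y) * weight f \<sigma>"
      by (simp only: sum_distrib_right[symmetric] sum_open_rows[OF \<sigma> f ab])
  qed simp
  also have "sum (weight f) A + \<dots> =
      placement_sum f a b k + (of_nat k + y) * placement_sum f a b (Suc k)"
    by (simp add: placement_sum_def A_def B_def sum_distrib_left)
  finally show ?thesis .
qed

section \<open>The weight marking right-to-left minima and left-to-right maxima\<close>

text \<open>A pivot carries both flags. Testing \<open>anti\<close> first gives it \<open>x\<close>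
  alone, hence the exponent \<open>LRmax - pivot\<close> of \<open>y\<close>.\<close>

definition xy_weight :: "'a::comm_ring_1 \<Rightarrow> 'a \<Rightarrow> bool \<Rightarrow> bool \<Rightarrow> 'a" where
  "xy_weight x y anti rec = (if anti then x else if rec then y else 1)"

lemma placement_sum_square_0: "placement_sum f 0 0 k = (if k = 0 then 1 else 0)"
proof -
  have "{\<sigma>. \<sigma> \<in> placements 0 0 \<and> card \<sigma> + k = 0} = (if k = 0 then {{}} else {})"
    by (auto simp: placements_def)
  then show ?thesis by (simp add: placement_sum_def weight_def)
qed

lemma xy_column_step:
  "placement_sum (xy_weight x y) n (Suc n) k =
    placement_sum (xy_weight x y) n n k +
    (of_nat k + y) * placement_sum (xy_weight x y) n n (Suc k)"
  by (rule placement_sum_add_column) (auto simp: xy_weight_def)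

text \<open>This is a column step on the transposed board with \<open>Suc n\<close> rows and
  \<open>n\<close> columns, where a pivot may arise; its weight \<open>x\<close> is the one the step
  requires.\<close>

lemma xy_row_step:
  fixes x y :: "'a::comm_ring_1"
  defines "f \<equiv> xy_weight x y"
  shows "placement_sum f (Suc n) (Suc n) 0 = x * placement_sum f n (Suc n) 0"
    and "placement_sum f (Suc n) (Suc n) (Suc k) = placement_sum f n (Suc n) k +
      (of_nat (Suc k) + x) * placement_sum f n (Suc n) (Suc k)"
proof -
  define f' where "f' = (\<lambda>s t. f t s)"
  have square: "placement_sum f (Suc n) (Suc n) k = placement_sum f' (Suc n) (Suc n) k" for k
    unfolding f'_def by (subst placement_sum_converse[symmetric]) (simp add: placement_sum_def)
  \<comment> \<open>There is one more column than rows, so \<open>k\<close> empty rows mean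
    \<open>Suc k\<close> empty columns.\<close>
  have rectangle: "placement_sum f n (Suc n) k = placement_sum f' (Suc n) n (Suc k)" for k
    unfolding f'_def by (subst placement_sum_converse[symmetric]) (simp add: placement_sum_def)
  have step: "placement_sum f' (Suc n) (Suc n) k =
      placement_sum f' (Suc n) n k + (of_nat k + x) * placement_sum f' (Suc n) n (Suc k)" for k
    by (rule placement_sum_add_column) (auto simp: f'_def f_def xy_weight_def)
  show "placement_sum f (Suc n) (Suc n) 0 = x * placement_sum f n (Suc n) 0"
    \<comment> \<open>The first term of \<open>step\<close> vanishes: \<open>n\<close> columns
      cannot fill \<open>Suc n\<close> rows.\<close>
    by (simp add: square rectangle step placement_sum_eq_0)
  show "placement_sum f (Suc n) (Suc n) (Suc k) = placement_sum f n (Suc n) k +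
      (of_nat (Suc k) + x) * placement_sum f n (Suc n) (Suc k)"
    by (simp only: square rectangle step)
qed

text \<open>Starting from the board with \<open>n\<close> rows and \<open>n + 1\<close> columns, a
  row step followed by a column step gives the diagonal coefficient \<open>(k + x) + (k + y)\<close>
  and the coefficient \<open>(k + 1 + x) * (k + y)\<close> of the term with \<open>k + 1\<close>
  empty rows.\<close>

lemma moment_eq_placement_sum:
  fixes x y :: "'a::comm_ring_1"
  shows "moment (\<lambda>k. 2 * of_nat k + x + y) (\<lambda>k. (of_nat k + x) * (of_nat k - 1 + y)) n =
    placement_sum (xy_weight x y) n (Suc n) 0"
  by (rule moment_eqI[where M = "\<lambda>n k. placement_sum (xy_weight x y) n (Suc n) k"])
    (simp_all add: xy_column_step xy_row_step placement_sum_square_0 algebra_simps)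

section \<open>Full permutations\<close>

lemma graph_in_placements:
  assumes "\<pi> permutes {1..N}"
  shows "(\<lambda>i. (i, \<pi> i)) ` {1..N} \<in> placements N N"
  using permutes_in_image[OF assms] permutes_inj[OF assms]
  by (auto simp: placements_def single_valued_def dest: injD)

lemma bij_betw_permutes_placements:
  "bij_betw (\<lambda>\<pi>. (\<lambda>i. (i, \<pi> i)) ` {1..N}) {\<pi>. \<pi> permutes {1..N}}
    {\<sigma>. \<sigma> \<in> placements N N \<and> card \<sigma> + 0 = N}"
proof (rule bij_betwI')
  fix \<pi> \<rho> assume *: "\<pi> \<in> {\<pi>. \<pi> permutes {1..N}}" "\<rho> \<in> {\<pi>. \<pi> permutes {1..N}}"
  show "(\<lambda>i. (i, \<pi> i)) ` {1..N} = (\<lambda>i. (i, \<rho> i)) ` {1..N} \<longleftrightarrow> \<pi> = \<rho>"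
  proof
    assume eq: "(\<lambda>i. (i, \<pi> i)) ` {1..N} = (\<lambda>i. (i, \<rho> i)) ` {1..N}"
    show "\<pi> = \<rho>"
    proof
      fix i show "\<pi> i = \<rho> i"
      proof (cases "i \<in> {1..N}")
        case True
        then have "(i, \<pi> i) \<in> (\<lambda>i. (i, \<rho> i)) ` {1..N}" using eq by blast
        then show ?thesis by auto
      next
        case False
        then show ?thesis using * by (simp add: permutes_not_in)
      qed
    qed
  qed simp
next
  fix \<pi> assume "\<pi> \<in> {\<pi>. \<pi> permutes {1..N}}"
  then show "(\<lambda>i. (i, \<pi> i)) ` {1..N} \<in> {\<sigma>. \<sigma> \<in> placements N N \<and> card \<sigma> + 0 = N}"
    using graph_in_placements[of \<pi> N] by (simp add: card_image inj_on_def)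
next
  fix \<sigma> assume "\<sigma> \<in> {\<sigma>. \<sigma> \<in> placements N N \<and> card \<sigma> + 0 = N}"
  then have \<sigma>: "\<sigma> \<in> placements N N" "card \<sigma> = N" by auto
  have sv: "v = w" if "(i, v) \<in> \<sigma>" "(i, w) \<in> \<sigma>" for i v w
    using \<sigma>(1) that by (auto simp: placements_def single_valued_def)
  have inj: "i = j" if "(i, v) \<in> \<sigma>" "(j, v) \<in> \<sigma>" for i j v
    using \<sigma>(1) that by (auto simp: placements_def single_valued_def)
  have sub: "\<sigma> \<subseteq> {1..N} \<times> {1..N}" using \<sigma>(1) by (simp add: placements_def)
  have Dom: "Domain \<sigma> = {1..N}"
    by (rule card_subset_eq) (use sub \<sigma>(2) card_Domain_placement[OF \<sigma>(1)] in auto)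
  \<comment> \<open>Outside \<open>{1..N}\<close> the identity is taken, as \<open>permutes\<close>
    demands.\<close>
  define \<pi> where "\<pi> i = (if i \<in> {1..N} then THE v. (i, v) \<in> \<sigma> else i)" for i
  have graph: "(i, \<pi> i) \<in> \<sigma>" if i: "i \<in> {1..N}" for i
  proof -
    obtain v where v: "(i, v) \<in> \<sigma>" using Dom i by blast
    then have "(THE v. (i, v) \<in> \<sigma>) = v" using sv by blast
    then show ?thesis using i v by (simp add: \<pi>_def)
  qed
  have "\<pi> permutes {1..N}"
  proof (rule bij_imp_permutes)
    have "inj_on \<pi> {1..N}" using graph inj by (metis inj_onI)
    moreover have "\<pi> ` {1..N} \<subseteq> {1..N}" using graph sub by blast
    ultimately show "bij_betw \<pi> {1..N} {1..N}"
      by (simp add: bij_betw_def endo_inj_surj)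
  qed (auto simp: \<pi>_def)
  moreover have "\<sigma> = (\<lambda>i. (i, \<pi> i)) ` {1..N}"
    using graph sv sub by (auto 0 3 simp: image_iff)
  ultimately show "\<exists>\<pi>\<in>{\<pi>. \<pi> permutes {1..N}}. \<sigma> = (\<lambda>i. (i, \<pi> i)) ` {1..N}" by blast
qed

text \<open>With every row and column filled, all smaller values occur to the left of a position
  exactly when none occurs to its right, so antirecords are the right-to-left minima.\<close>

lemma weight_permutation:
  assumes \<pi>: "\<pi> permutes {1..N}"
  shows "weight (xy_weight x y) ((\<lambda>i. (i, \<pi> i)) ` {1..N}) =
    x ^ RLmin N \<pi> * y ^ (LRmax N \<pi> - pivot N \<pi>)"
proof -
  let ?\<sigma> = "(\<lambda>i. (i, \<pi> i)) ` {1..N}"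
  let ?A = "rl_minima N \<pi>" and ?R = "lr_maxima N \<pi>"
  have mem: "(j, w) \<in> ?\<sigma> \<longleftrightarrow> j \<in> {1..N} \<and> w = \<pi> j" for j w by auto
  have rec: "is_record ?\<sigma> (i, \<pi> i) \<longleftrightarrow> i \<in> ?R" if "i \<in> {1..N}" for i
    using that unfolding is_record_def mem by (auto simp: lr_maxima_def)
  have anti: "is_antirecord ?\<sigma> (i, \<pi> i) \<longleftrightarrow> i \<in> ?A" if i: "i \<in> {1..N}" for i
  proof
    assume *: "is_antirecord ?\<sigma> (i, \<pi> i)"
    have "\<pi> i < \<pi> j" if j: "j \<in> {1..N}" "i < j" for j
    proof (rule ccontr)
      assume "\<not> \<pi> i < \<pi> j"
      moreover have "\<pi> i \<noteq> \<pi> j" using j permutes_inj[OF \<pi>] by (auto dest: injD)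
      moreover have "\<pi> j \<in> {1..N}" using j permutes_in_image[OF \<pi>] by blast
      ultimately have "\<pi> j \<in> {1..<\<pi> i}" by simp
      then obtain j' where "j' < i" "(j', \<pi> j) \<in> ?\<sigma>"
        using * unfolding is_antirecord_def fst_conv snd_conv by blast
      then have "j' = j" using permutes_inj[OF \<pi>] by (auto dest: injD)
      then show False using \<open>j' < i\<close> j by simp
    qed
    then show "i \<in> ?A" using i by (simp add: rl_minima_def)
  next
    assume A: "i \<in> ?A"
    show "is_antirecord ?\<sigma> (i, \<pi> i)"
      unfolding is_antirecord_def
    proof
      fix w assume w: "w \<in> {1..<snd (i, \<pi> i)}"
      have "\<pi> i \<in> {1..N}" using i permutes_in_image[OF \<pi>] by blast
      then have "w \<in> \<pi> ` {1..N}" using w permutes_image[OF \<pi>] by auto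
      then obtain j where j: "j \<in> {1..N}" "w = \<pi> j" by blast
      then have "\<pi> j < \<pi> i" using w by simp
      then have "j < i" using A j by (metis (mono_tags, lifting) linorder_neqE_nat mem_Collect_eq
        order_less_asym order_less_irrefl rl_minima_def)
      then show "\<exists>j<fst (i, \<pi> i). (j, w) \<in> ?\<sigma>" using j by auto
    qed
  qed
  have [simp]: "finite ?A" "finite ?R"
    by (simp_all add: rl_minima_def lr_maxima_def)
  have "weight (xy_weight x y) ?\<sigma> =
      (\<Prod>i\<in>{1..N}. xy_weight x y (is_antirecord ?\<sigma> (i, \<pi> i)) (is_record ?\<sigma> (i, \<pi> i)))"
    unfolding weight_def by (subst prod.reindex) (auto simp: inj_on_def)
  \<comment> \<open>Only maxima that are not minima get \<open>y\<close>, and \<open>?R - ?A\<close>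
    has \<open>LRmax - pivot\<close> elements.\<close>
  also have "\<dots> = (\<Prod>i\<in>{1..N}. (if i \<in> ?A then x else 1) * (if i \<in> ?R - ?A then y else 1))"
    by (rule prod.cong[OF refl]) (simp only: rec anti, simp add: xy_weight_def)
  also have "\<dots> = (\<Prod>i\<in>{1..N} \<inter> ?A. x) * (\<Prod>i\<in>{1..N} \<inter> (?R - ?A). y)"
    by (simp only: prod.distrib prod.inter_restrict[symmetric] finite_atLeastAtMost)
  also have "{1..N} \<inter> ?A = ?A" by (auto simp: rl_minima_def)
  also have "{1..N} \<inter> (?R - ?A) = ?R - ?A" by (auto simp: lr_maxima_def)
  finally show ?thesis
    by (simp add: RLmin_def LRmax_def pivot_def card_Diff_subset_Int)
qed

lemma sum_permutations_eq_placement_sum: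
  "(\<Sum>\<pi> | \<pi> permutes {1..N}. x ^ RLmin N \<pi> * y ^ (LRmax N \<pi> - pivot N \<pi>)) =
    placement_sum (xy_weight x y) N N 0"
  unfolding placement_sum_def
  by (subst sum.reindex_bij_betw[OF bij_betw_permutes_placements, symmetric])
    (rule sum.cong, simp_all only: weight_permutation mem_Collect_eq)

text \<open>As a constant in \<open>Y\<close>, \<open>indet_X\<close> acts on each coefficient by a
  degree shift, which is injective even if the base ring has zero divisors.\<close>

lemma indet_X_mult_cancel:
  assumes "indet_X * p = indet_X * q"
  shows "p = q"
proof (rule poly_eqI)
  fix n
  have "coeff (indet_X * p) n = coeff (indet_X * q) n" using assms by simp
  then show "coeff p n = coeff q n" by (simp add: indet_X_def)
qed

theorem theorem3p6:
  fixes X Y :: "'a::comm_ring_1 poly poly" and n :: nat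
  defines "X \<equiv> indet_X" and "Y \<equiv> indet_Y"
  shows "moment (\<lambda>k. 2 * of_nat k + X + Y) (\<lambda>k. (of_nat k + X) * (of_nat k - 1 + Y)) n =
    (\<Sum>\<pi> | \<pi> permutes {1..n + 1}.
       X ^ (RLmin (n + 1) \<pi> - 1) * Y ^ (LRmax (n + 1) \<pi> - pivot (n + 1) \<pi>))"
    (is "?\<mu> = ?S")
proof -
  \<comment> \<open>The last row has to take the single empty column, which contributes the factor
    \<open>X\<close>.\<close>
  have "X * ?\<mu> = placement_sum (xy_weight X Y) (n + 1) (n + 1) 0"
    by (simp add: moment_eq_placement_sum xy_row_step)
  also have "\<dots> = (\<Sum>\<pi> | \<pi> permutes {1..n + 1}.
      X ^ RLmin (n + 1) \<pi> * Y ^ (LRmax (n + 1) \<pi> - pivot (n + 1) \<pi>))"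
    by (rule sum_permutations_eq_placement_sum[symmetric])
  also have "\<dots> = X * ?S"
    unfolding sum_distrib_left
  proof (rule sum.cong)
    fix \<pi>
    have "X ^ RLmin (n + 1) \<pi> = X * X ^ (RLmin (n + 1) \<pi> - 1)"
      using RLmin_ge_1[of n \<pi>] by (simp flip: power_Suc)
    then show "X ^ RLmin (n + 1) \<pi> * Y ^ (LRmax (n + 1) \<pi> - pivot (n + 1) \<pi>) =
        X * (X ^ (RLmin (n + 1) \<pi> - 1) * Y ^ (LRmax (n + 1) \<pi> - pivot (n + 1) \<pi>))"
      by (simp only: mult.assoc)
  qed simp
  finally show ?thesis
    unfolding X_def by (rule indet_X_mult_cancel)
qed

end
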